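(* Let $\mathbb{H}_{\mathbb{R}}$ be the quaternion algebra over the field of real numbers and let $f,g,h:\mathbb{H}_{\mathbb{R}}\to\mathbb{H}_{\mathbb{R}}$ be $\mathbb{R}$-linear maps. Then $f$ is a Jordan left $\{g,h\}$-derivation if and only if $g=h$ and there exist $4$ elements $a_g^{(1)},b_g^{(1)},c_g^{(1)},d_g^{(1)}\in\mathbb{R}$ such that for every $q=a+bi+cj+dk\in\mathbb{H}_{\mathbb{R}}$ (with $a,b,c,d\in\mathbb{R}$), $$\begin{aligned}g(q)=\;&(aa_g^{(1)}-bb_g^{(1)}-cc_g^{(1)}-dd_g^{(1)})+(ab_g^{(1)}+ba_g^{(1)}+cd_g^{(1)}-dc_g^{(1)})i\\&+(ac_g^{(1)}-bd_g^{(1)}+ca_g^{(1)}+db_g^{(1)})j+(ad_g^{(1)}+bc_g^{(1)}-cb_g^{(1)}+da_g^{(1)})k,\end{aligned}$$ $$f(q)=2g(q).$$ Moreover, if $f$ is a Jordan left $\{g,g\}$-derivation of $\mathbb{H}_{\mathbb{R}}$, then $f$ and $g$ are right centralizers.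
   Context: $\mathbb{H}_{\mathbb{R}}=\{a+bi+cj+dk\mid a,b,c,d\in\mathbb{R}\}$ with $i^2=j^2=k^2=ijk=-1$. For an algebra $A$ over $\mathbb{R}$ and $\mathbb{R}$-linear maps $f,g,h:A\to A$, $f$ is a Jordan left $\{g,h\}$-derivation if $f(ab+ba)=2\big(a\,g(b)+b\,h(a)\big)$ for all $a,b\in A$; a Jordan left $\{g,g\}$-derivation is the case $h=g$. A linear map $\varphi:A\to A$ is a right centralizer if $\varphi(ab)=a\varphi(b)$ for all $a,b\in A$. *)

theory Defs
  imports Complex_Main
begin

(* Quat a b c d stands for a + b i + c j + d k. *)
datatype quat = Quat (Qre: real) (Qi: real) (Qj: real) (Qk: real)

lemma quat_eq_iff:
  "x = y \<longleftrightarrow> Qre x = Qre y \<and> Qi x = Qi y \<and> Qj x = Qj y \<and> Qk x = Qk y"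
  by (auto intro: quat.expand)

instantiation quat :: real_algebra_1
begin

definition "0 = Quat 0 0 0 0"

definition "1 = Quat 1 0 0 0"

definition "x + y = Quat (Qre x + Qre y) (Qi x + Qi y) (Qj x + Qj y) (Qk x + Qk y)"

definition "- x = Quat (- Qre x) (- Qi x) (- Qj x) (- Qk x)"

definition "x - y = Quat (Qre x - Qre y) (Qi x - Qi y) (Qj x - Qj y) (Qk x - Qk y)"

definition "r *\<^sub>R x = Quat (r * Qre x) (r * Qi x) (r * Qj x) (r * Qk x)"

(* The Hamilton product, i.e. the bilinear extension of i^2 = j^2 = k^2 = ijk = -1;
   see quat_unit_relations below. *)
definition "x * y = Quat
  (Qre x * Qre y - Qi x * Qi y - Qj x * Qj y - Qk x * Qk y)
  (Qre x * Qi y + Qi x * Qre y + Qj x * Qk y - Qk x * Qj y)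
  (Qre x * Qj y - Qi x * Qk y + Qj x * Qre y + Qk x * Qi y)
  (Qre x * Qk y + Qi x * Qj y - Qj x * Qi y + Qk x * Qre y)"

instance
  by standard
    (simp_all add: quat_eq_iff zero_quat_def one_quat_def plus_quat_def uminus_quat_def
      minus_quat_def scaleR_quat_def times_quat_def algebra_simps)

end

definition quat_i :: quat where "quat_i = Quat 0 1 0 0"
definition quat_j :: quat where "quat_j = Quat 0 0 1 0"
definition quat_k :: quat where "quat_k = Quat 0 0 0 1"

lemma quat_unit_relations:
  "quat_i\<^sup>2 = - 1" "quat_j\<^sup>2 = - 1" "quat_k\<^sup>2 = - 1" "quat_i * quat_j * quat_k = - 1"
  by (simp_all add: quat_i_def quat_j_def quat_k_def one_quat_def uminus_quat_def
      times_quat_def power2_eq_square)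

lemma Quat_eq:
  "Quat a b c d = of_real a + b *\<^sub>R quat_i + c *\<^sub>R quat_j + d *\<^sub>R quat_k"
  by (simp add: of_real_def quat_i_def quat_j_def quat_k_def one_quat_def plus_quat_def
      scaleR_quat_def)

(* Used only for linear f, g, h; linearity is a separate hypothesis. *)
definition jordan_left_derivation ::
    "('a::real_algebra \<Rightarrow> 'a) \<Rightarrow> ('a \<Rightarrow> 'a) \<Rightarrow> ('a \<Rightarrow> 'a) \<Rightarrow> bool" where
  "jordan_left_derivation f g h \<longleftrightarrow>
     (\<forall>a b. f (a * b + b * a) = 2 *\<^sub>R (a * g b + b * h a))"

definition right_centralizer :: "('a::real_algebra \<Rightarrow> 'a) \<Rightarrow> bool" where
  "right_centralizer \<phi> \<longleftrightarrow> linear \<phi> \<and> (\<forall>a b. \<phi> (a * b) = a * \<phi> b)"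

end

theory Submission
  imports Defs
begin

text \<open>Swapping the arguments in the defining identity shows that \<open>D = g - h\<close> satisfies
  \<open>a D(b) = b D(a)\<close>, so \<open>D\<close> is right multiplication by \<open>D(1)\<close> and every commutator
  annihilates \<open>D(1)\<close>; since \<open>ij - ji = 2k\<close> is invertible, \<open>g = h\<close>. The map
  \<open>G(a) = g(a) - a g(1)\<close> then satisfies \<open>G(a\<^sup>2) = 2 a G(a)\<close> and \<open>G(1) = 0\<close>. As \<open>i\<close>, \<open>j\<close>, \<open>k\<close>
  are invertible with square \<open>-1\<close>, \<open>G\<close> vanishes on them, so \<open>G = 0\<close>: the map \<open>g\<close> is right
  multiplication by \<open>g(1)\<close>, and \<open>f = 2 g\<close>.\<close>

lemma jordan_left_derivation_commutator:
  fixes f g h :: "'a::real_algebra_1 \<Rightarrow> 'a"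
  assumes "jordan_left_derivation f g h"
  shows "g a - h a = a * (g 1 - h 1)" and "(a * b - b * a) * (g 1 - h 1) = 0"
proof -
  have sym: "x * (g y - h y) = y * (g x - h x)" for x y
  proof -
    have "2 *\<^sub>R (x * g y + y * h x) = 2 *\<^sub>R (y * g x + x * h y)"
      using assms unfolding jordan_left_derivation_def by (metis add.commute)
    then have "x * g y + y * h x = y * g x + x * h y" by simp
    then show ?thesis by (simp add: algebra_simps)
  qed
  have right_mult: "g x - h x = x * (g 1 - h 1)" for x
    using sym[of 1 x] by simp
  then show "g a - h a = a * (g 1 - h 1)" .
  have "a * (b * (g 1 - h 1)) = b * (a * (g 1 - h 1))"
    using sym[of a b] unfolding right_mult[of a] right_mult[of b] .
  then show "(a * b - b * a) * (g 1 - h 1) = 0"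
    by (simp add: algebra_simps)
qed

text \<open>Putting \<open>b = 1\<close> in the identity expresses \<open>f\<close> through
  \<open>g\<close>, so that \<open>f\<close> can be eliminated from it.\<close>

lemma jordan_left_derivation_left_map:
  fixes f g :: "'a::real_algebra_1 \<Rightarrow> 'a"
  assumes "linear f" and "jordan_left_derivation f g g"
  shows "f a = a * g 1 + g a"
proof -
  have "f (a * 1 + 1 * a) = 2 *\<^sub>R (a * g 1 + 1 * g a)"
    using assms(2) unfolding jordan_left_derivation_def by blast
  then have "2 *\<^sub>R f a = 2 *\<^sub>R (a * g 1 + g a)"
    by (simp add: linear_scale[OF assms(1)] flip: scaleR_2)
  then show ?thesis by simp
qed

text \<open>Two evaluations of \<open>f (u * u)\<close> are compared: the identity with both
  arguments \<open>u\<close> gives twice \<open>u * g u\<close>, while eliminating \<open>f\<close>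
  gives twice \<open>- g 1\<close>. This is the vanishing of \<open>G\<close> at \<open>u\<close>,
  with \<open>G\<close> left implicit.\<close>

lemma jordan_left_derivation_root_minus_one:
  fixes f g :: "'a::real_algebra_1 \<Rightarrow> 'a"
  assumes "linear f" "linear g" and "jordan_left_derivation f g g" and u: "u * u = - 1"
  shows "g u = u * g 1"
proof -
  have "f (u * u + u * u) = 2 *\<^sub>R (u * g u + u * g u)"
    using assms(3) unfolding jordan_left_derivation_def by blast
  then have "2 *\<^sub>R f (u * u) = 2 *\<^sub>R (2 *\<^sub>R (u * g u))"
    by (simp only: linear_scale[OF assms(1)] flip: scaleR_2)
  then have "f (u * u) = 2 *\<^sub>R (u * g u)"
    by (simp only: scaleR_cancel_left) simp
  moreover have "f (u * u) = 2 *\<^sub>R (- g 1)"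
    using jordan_left_derivation_left_map[OF assms(1,3), of "u * u"]
    by (simp add: u linear_neg[OF assms(2)] scaleR_2)
  ultimately have "2 *\<^sub>R (u * g u) = 2 *\<^sub>R (- g 1)" by (rule trans[OF sym])
  then have "u * g u = - g 1" by (simp only: scaleR_cancel_left) simp
  \<comment> \<open>Since \<open>u * u = - 1\<close>, a further left multiplication by
    \<open>u\<close> cancels the factor \<open>u\<close> up to sign.\<close>
  then have "u * (u * g u) = - (u * g 1)" by simp
  then show ?thesis by (simp add: u flip: mult.assoc)
qed

lemma right_multiplication_right_centralizer:
  fixes \<phi> :: "'a::real_algebra \<Rightarrow> 'a"
  assumes "linear \<phi>" and "\<And>x. \<phi> x = x * e"
  shows "right_centralizer \<phi>"
  using assms by (simp add: right_centralizer_def mult.assoc)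

lemma quat_unit_squares:
  "quat_i * quat_i = - 1" "quat_j * quat_j = - 1" "quat_k * quat_k = - 1"
  using quat_unit_relations by (simp_all add: power2_eq_square)

lemma quat_commutator_ij: "quat_i * quat_j - quat_j * quat_i = 2 *\<^sub>R quat_k"
  by (simp add: quat_i_def quat_j_def quat_k_def times_quat_def minus_quat_def scaleR_quat_def)

lemma jordan_left_derivation_quat_eq:
  fixes f g h :: "quat \<Rightarrow> quat"
  assumes "jordan_left_derivation f g h"
  shows "g = h"
proof -
  let ?e = "g 1 - h 1"
  have "quat_k * ?e = 0"
    using jordan_left_derivation_commutator(2)[OF assms, of quat_i quat_j]
    by (simp add: quat_commutator_ij)
  \<comment> \<open>A second factor \<open>quat_k\<close> turns the product into
    \<open>- ?e\<close>.\<close>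
  then have "quat_k * quat_k * ?e = 0" by (simp only: mult.assoc mult_zero_right)
  then have "?e = 0" by (simp add: quat_unit_squares)
  then have "g a - h a = 0" for a
    using jordan_left_derivation_commutator(1)[OF assms, of a] by (simp only: mult_zero_right)
  then show "g = h" by (simp add: fun_eq_iff)
qed

text \<open>Both sides of the formula for \<open>g\<close> are linear in \<open>q\<close> and agree
  on the basis 1, i, j, k.\<close>

lemma jordan_left_derivation_quat:
  fixes f g :: "quat \<Rightarrow> quat"
  assumes "linear f" "linear g" and "jordan_left_derivation f g g"
  shows "g q = q * g 1" and "f q = 2 *\<^sub>R g q"
proof -
  have units: "g quat_i = quat_i * g 1" "g quat_j = quat_j * g 1" "g quat_k = quat_k * g 1"
    by (intro jordan_left_derivation_root_minus_one[OF assms] quat_unit_squares)+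
  obtain a b c d where "q = Quat a b c d" by (cases q)
  then have q: "q = a *\<^sub>R 1 + b *\<^sub>R quat_i + c *\<^sub>R quat_j + d *\<^sub>R quat_k"
    by (simp add: Quat_eq of_real_def)
  show "g q = q * g 1"
    unfolding q by (simp add: linear_add[OF assms(2)] linear_scale[OF assms(2)] units distrib_right)
  then show "f q = 2 *\<^sub>R g q"
    using jordan_left_derivation_left_map[OF assms(1,3)] by (simp add: scaleR_2)
qed

lemma right_multiplication_jordan_left_derivation:
  fixes f g :: "'a::real_algebra \<Rightarrow> 'a"
  assumes "\<And>x. g x = x * e" and "\<And>x. f x = 2 *\<^sub>R g x"
  shows "jordan_left_derivation f g g"
  by (simp add: jordan_left_derivation_def assms distrib_right mult.assoc)

text \<open>Read from right to left, this identifies the coordinate formula of the theorem as right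
  multiplication by a fixed quaternion.\<close>

lemma quat_mult_expand:
  "Quat a b c d * Quat a' b' c' d' =
     of_real (a * a' - b * b' - c * c' - d * d')
     + (a * b' + b * a' + c * d' - d * c') *\<^sub>R quat_i
     + (a * c' - b * d' + c * a' + d * b') *\<^sub>R quat_j
     + (a * d' + b * c' - c * b' + d * a') *\<^sub>R quat_k"
  unfolding Quat_eq[symmetric] by (simp add: times_quat_def)

theorem theorem5p2:
  fixes f g h :: "quat \<Rightarrow> quat"
  assumes "linear f" and "linear g" and "linear h"
  shows "(jordan_left_derivation f g h \<longleftrightarrow>
      g = h \<and>
      (\<exists>a\<^sub>g b\<^sub>g c\<^sub>g d\<^sub>g :: real. \<forall>(q :: quat) (a :: real) (b :: real) (c :: real) (d :: real).
         q = of_real a + b *\<^sub>R quat_i + c *\<^sub>R quat_j + d *\<^sub>R quat_k \<longrightarrow>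
         g q = of_real (a * a\<^sub>g - b * b\<^sub>g - c * c\<^sub>g - d * d\<^sub>g)
             + (a * b\<^sub>g + b * a\<^sub>g + c * d\<^sub>g - d * c\<^sub>g) *\<^sub>R quat_i
             + (a * c\<^sub>g - b * d\<^sub>g + c * a\<^sub>g + d * b\<^sub>g) *\<^sub>R quat_j
             + (a * d\<^sub>g + b * c\<^sub>g - c * b\<^sub>g + d * a\<^sub>g) *\<^sub>R quat_k \<and>
         f q = 2 *\<^sub>R g q))
    \<and> (jordan_left_derivation f g g \<longrightarrow> right_centralizer f \<and> right_centralizer g)"
  (is "(_ \<longleftrightarrow> ?R) \<and> _")
proof (intro conjI impI)
  show "jordan_left_derivation f g h \<longleftrightarrow> ?R"
    \<comment> \<open>The products are folded first, because the reversed \<open>Quat_eq\<close>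
      also matches their four-term sums.\<close>
    unfolding quat_mult_expand[symmetric] unfolding Quat_eq[symmetric]
  proof (intro iffI conjI)
    assume jld: "jordan_left_derivation f g h"
    then show "g = h" by (rule jordan_left_derivation_quat_eq)
    then have jld: "jordan_left_derivation f g g" using jld by simp
    \<comment> \<open>The four real constants are the coordinates of \<open>g 1\<close>.\<close>
    obtain a' b' c' d' where e: "g 1 = Quat a' b' c' d'" by (cases "g 1")
    show "\<exists>a' b' c' d'. \<forall>q a b c d. q = Quat a b c d \<longrightarrow>
        g q = Quat a b c d * Quat a' b' c' d' \<and> f q = 2 *\<^sub>R g q"
      using jordan_left_derivation_quat[OF assms(1,2) jld, unfolded e] by blast
  next
    assume "g = h \<and> (\<exists>a' b' c' d'. \<forall>q a b c d. q = Quat a b c d \<longrightarrow>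
        g q = Quat a b c d * Quat a' b' c' d' \<and> f q = 2 *\<^sub>R g q)"
    then obtain a' b' c' d' where "g = h"
      and formula: "\<forall>q a b c d. q = Quat a b c d \<longrightarrow>
        g q = Quat a b c d * Quat a' b' c' d' \<and> f q = 2 *\<^sub>R g q"
      by (elim conjE exE)
    have "g q = q * Quat a' b' c' d'" and "f q = 2 *\<^sub>R g q" for q
      using formula by (cases q; simp)+
    then show "jordan_left_derivation f g h"
      unfolding \<open>g = h\<close>[symmetric] by (rule right_multiplication_jordan_left_derivation)
  qed
next
  assume "jordan_left_derivation f g g"
  note g = jordan_left_derivation_quat(1)[OF assms(1,2) this]
    and f = jordan_left_derivation_quat(2)[OF assms(1,2) this]
  show "right_centralizer g"
    using assms(2) g by (rule right_multiplication_right_centralizer)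
  have "f q = q * (2 *\<^sub>R g 1)" for q
    using f[of q] g[of q] by simp
  with assms(1) show "right_centralizer f"
    by (rule right_multiplication_right_centralizer)
qed

end
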